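(* Let $\mathbb{E}$ be a (finite-dimensional) Euclidean space, let $f\in\Gamma_0(\mathbb{E})$, $(\bar x,\bar\alpha)\in\mathbb{E}\times\mathbb{R}$, and assume there exists $\hat x\in\mathbb{E}$ such that $f(\hat x)<\bar\alpha$. Let $\mathrm{lev}_{\bar\alpha}f=\{x\in\mathbb{E}\mid f(x)\le\bar\alpha\}$. Then the following statements hold. (a) (Dual representation of distance to level set) $\frac12d^2_{\mathrm{lev}_{\bar\alpha}f}(\bar x)=-\min_{\lambda\ge0}\{\bar\phi^f_{\bar x}(\lambda)+\bar\alpha\lambda\}$. (b) (Projection onto level set) $$P_{\mathrm{lev}_{\bar\alpha}f}(\bar x)=\begin{cases}P_{\mathrm{cl}(\mathrm{dom} f)}(\bar x)&\text{if }f(P_{\mathrm{cl}(\mathrm{dom} f)}(\bar x))\le\bar\alpha,\\P_{\bar\lambda}f(\bar x)&\text{otherwise},\end{cases}$$ for any positive $\bar\lambda$ in the optimal solution set $$\mathrm{argmin}_{\lambda\ge0}\{\bar\phi^f_{\bar x}(\lambda)+\bar\alpha\lambda\}=\{\lambda\ge0\mid f(P_\lambda f(\bar x))=\bar\alpha\}\ne\emptyset.$$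
   Context: $\Gamma_0(\mathbb{E})$ denotes the closed proper convex functions $\mathbb{E}\to\mathbb{R}\cup\{+\infty\}$. For $\lambda>0$, $e_\lambda f(x)=\min_{u\in\mathbb{E}}\{f(u)+\frac1{2\lambda}\|x-u\|^2\}$ and $P_\lambda f(x)$ is the unique minimizer; for $\lambda=0$, $P_0f$ is understood as $P_{\mathrm{cl}(\mathrm{dom} f)}$. $P_C$ and $d_C$ are the Euclidean projection onto and distance to a closed convex set $C$. The function $\bar\phi^f_{\bar x}$ is defined on $\mathbb{R}$ by $$\bar\phi^f_{\bar x}(\lambda)=\begin{cases}-\lambda e_\lambda f(\bar x)&\text{if }\lambda>0,\\-\frac12d^2_{\mathrm{cl}(\mathrm{dom} f)}(\bar x)&\text{if }\lambda=0,\\-\lambda f(P_{\mathrm{cl}(\mathrm{dom} f)}(\bar x))-\frac12d^2_{\mathrm{cl}(\mathrm{dom} f)}(\bar x)&\text{if }\lambda<0.\end{cases}$$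
   Formalization: The set equality in (b), with non-emptiness of its right side, is stated only when f(P_cl(dom f)(x̄)) ≥ ᾱ; otherwise it fails (f=0, ᾱ=1: argmin is {0}, right side empty). Non-emptiness of the argmin is kept in all cases. E has dimension at least 1. *)

theory Defs
  imports "HOL-Analysis.Analysis"
begin

definition epi :: "('a::real_normed_vector \<Rightarrow> ereal) \<Rightarrow> ('a \<times> real) set" where
  "epi f = {(x, r). f x \<le> ereal r}"

definition edom :: "('a \<Rightarrow> ereal) \<Rightarrow> 'a set" where
  "edom f = {x. f x < \<infinity>}"

text \<open>Convexity and closedness (lower semicontinuity) are those of the epigraph.\<close>

definition Gamma0 :: "('a::euclidean_space \<Rightarrow> ereal) set" where
  "Gamma0 = {f. (\<forall>x. f x \<noteq> -\<infinity>) \<and> edom f \<noteq> {} \<and> convex (epi f) \<and> closed (epi f)}"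

definition lev :: "real \<Rightarrow> ('a \<Rightarrow> ereal) \<Rightarrow> 'a set" where
  "lev \<alpha> f = {x. f x \<le> ereal \<alpha>}"

definition argmin_on :: "('b \<Rightarrow> ereal) \<Rightarrow> 'b set \<Rightarrow> 'b set" where
  "argmin_on g S = {x. is_arg_min g (\<lambda>y. y \<in> S) x}"

definition prox_obj :: "real \<Rightarrow> ('a::euclidean_space \<Rightarrow> ereal) \<Rightarrow> 'a \<Rightarrow> 'a \<Rightarrow> ereal" where
  "prox_obj \<mu> f x u = f u + ereal (1 / (2 * \<mu>) * (norm (x - u))\<^sup>2)"

text \<open>For \<open>\<mu> > 0\<close> and \<open>f \<in> Gamma0\<close> the infimum is attained, at exactly one point.\<close>

definition envelope :: "real \<Rightarrow> ('a::euclidean_space \<Rightarrow> ereal) \<Rightarrow> 'a \<Rightarrow> ereal" where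
  "envelope \<mu> f x = (INF u. prox_obj \<mu> f x u)"

text \<open>Only \<open>\<mu> \<ge> 0\<close> is meaningful; \<open>\<mu> = 0\<close> is the conventional limiting case.\<close>

definition prox :: "real \<Rightarrow> ('a::euclidean_space \<Rightarrow> ereal) \<Rightarrow> 'a \<Rightarrow> 'a" where
  "prox \<mu> f x =
     (if \<mu> = 0 then closest_point (closure (edom f)) x
      else (THE u. u \<in> argmin_on (prox_obj \<mu> f x) UNIV))"

text \<open>The values for \<open>\<mu> \<ge> 0\<close> are finite when \<open>f \<in> Gamma0\<close>; for \<open>\<mu> < 0\<close> the value is \<open>\<infinity>\<close>
  when the projection of \<open>x\<close> onto the closure of the domain is not in the domain.\<close>

definition phi_bar :: "('a::euclidean_space \<Rightarrow> ereal) \<Rightarrow> 'a \<Rightarrow> real \<Rightarrow> ereal" where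
  "phi_bar f x \<mu> =
     (if \<mu> > 0 then ereal (- \<mu>) * envelope \<mu> f x
      else if \<mu> = 0 then ereal (- (1/2) * (infdist x (closure (edom f)))\<^sup>2)
      else ereal (- \<mu>) * f (closest_point (closure (edom f)) x)
             - ereal (1/2 * (infdist x (closure (edom f)))\<^sup>2))"

definition dual_obj :: "('a::euclidean_space \<Rightarrow> ereal) \<Rightarrow> 'a \<Rightarrow> real \<Rightarrow> real \<Rightarrow> ereal" where
  "dual_obj f x \<alpha> \<mu> = phi_bar f x \<mu> + ereal (\<alpha> * \<mu>)"

end

theory Submission
  imports Defs
begin

text \<open>
  Write \<open>L(\<mu>, u) = \<mu> (f u - \<alpha>) + \<parallel>x - u\<parallel>\<^sup>2 / 2\<close> for the Lagrangian of the problem of minimizing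
  \<open>\<parallel>x - u\<parallel>\<^sup>2 / 2\<close> subject to \<open>f u \<le> \<alpha>\<close>. For \<open>\<mu> > 0\<close> the proximal objective is
  \<open>L(\<mu>, \<cdot>) / \<mu> + \<alpha>\<close>, so the dual objective at \<open>\<mu>\<close> is \<open>- min\<^sub>u L(\<mu>, u)\<close>, attained exactly at
  the proximal point; for \<open>\<mu> = 0\<close> it is minus the infimum of \<open>L(0, \<cdot>)\<close> over the domain of \<open>f\<close>,
  because the distances to a set and to its closure agree. Everything is therefore Lagrangian
  duality for this problem.

  Existence of the proximal point comes from an affine minorant of \<open>f\<close> (\<open>Gamma0_affine_minorant\<close>),
  which makes the proximal objective coercive; uniqueness comes from strong convexity of the
  square of the norm. Since \<open>f\<close> takes a value below \<open>\<alpha>\<close>, Slater's condition holds, and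
  separating two convex sets in the plane gives a multiplier \<open>\<mu> \<ge> 0\<close> with
  \<open>L(\<mu>, u) \<ge> d\<^sup>2 / 2\<close> for all \<open>u\<close>, where \<open>d\<close> is the distance from \<open>x\<close> to the level set
  (\<open>slater_multiplier\<close>). With weak duality this is the dual formula with attainment.

  Let \<open>p\<close> be the projection of \<open>x\<close> onto the level set. A multiplier \<open>\<mu> > 0\<close> is optimal iff
  \<open>min\<^sub>u L(\<mu>, u) = \<parallel>x - p\<parallel>\<^sup>2 / 2\<close>. As \<open>L(\<mu>, p) \<le> \<parallel>x - p\<parallel>\<^sup>2 / 2\<close>, optimality forces \<open>p\<close> to be the
  minimizer, that is the proximal point, and \<open>f p = \<alpha>\<close>. Conversely, if \<open>f\<close> equals \<open>\<alpha>\<close> at the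
  proximal point then \<open>\<mu>\<close> is optimal by weak duality (\<open>dual_optimal_pos_iff\<close>). Finally, \<open>\<mu> = 0\<close>
  is optimal iff the level set and the domain are equally far from \<open>x\<close>, that is iff the
  projection onto the closed domain lies in the level set.
\<close>

section \<open>Closed proper convex functions\<close>

lemma Gamma0_real_on_edom:
  assumes "f \<in> Gamma0" "u \<in> edom f"
  shows "f u = ereal (real_of_ereal (f u))"
  using assms by (cases "f u") (auto simp: Gamma0_def edom_def)

lemma Gamma0_edom_convex:
  fixes f :: "'a::euclidean_space \<Rightarrow> ereal"
  assumes "f \<in> Gamma0"
  shows "convex (edom f)"
proof -
  have "edom f = fst ` epi f"
  proof (intro equalityI subsetI)
    fix u assume "u \<in> edom f"
    then have "(u, real_of_ereal (f u)) \<in> epi f"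
      using Gamma0_real_on_edom[OF assms, of u] by (auto simp: epi_def)
    then show "u \<in> fst ` epi f" by force
  next
    fix u assume "u \<in> fst ` epi f"
    then show "u \<in> edom f" by (auto simp: epi_def edom_def)
  qed
  moreover have "convex (fst ` epi f)"
    using assms by (intro convex_linear_image linear_fst) (auto simp: Gamma0_def)
  ultimately show ?thesis by simp
qed

lemma Gamma0_lev_closed_convex:
  fixes f :: "'a::euclidean_space \<Rightarrow> ereal"
  assumes "f \<in> Gamma0"
  shows "closed (lev \<alpha> f)" "convex (lev \<alpha> f)"
proof -
  have eq: "lev \<alpha> f = (\<lambda>u. (u, \<alpha>)) -` epi f" by (auto simp: lev_def epi_def)
  show "closed (lev \<alpha> f)" unfolding eq
    using assms by (intro closed_vimage) (auto simp: Gamma0_def intro!: continuous_intros)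
  show "convex (lev \<alpha> f)"
  proof (rule convexI)
    fix u v and a b :: real
    assume uv: "u \<in> lev \<alpha> f" "v \<in> lev \<alpha> f" and ab: "0 \<le> a" "0 \<le> b" "a + b = 1"
    have "a *\<^sub>R (u, \<alpha>) + b *\<^sub>R (v, \<alpha>) \<in> epi f"
      using assms uv ab by (intro convexD) (auto simp: Gamma0_def eq)
    moreover have "a * \<alpha> + b * \<alpha> = \<alpha>" using ab by (simp flip: distrib_right)
    ultimately show "a *\<^sub>R u + b *\<^sub>R v \<in> lev \<alpha> f" by (simp add: eq)
  qed
qed

lemma Gamma0_affine_minorant:
  fixes f :: "'a::euclidean_space \<Rightarrow> ereal"
  assumes "f \<in> Gamma0"
  obtains g c where "\<And>u r. (u, r) \<in> epi f \<Longrightarrow> inner g u + c \<le> r"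
proof -
  obtain w where w: "w \<in> edom f" using assms by (auto simp: Gamma0_def)
  define s where "s = real_of_ereal (f w)"
  have fw: "f w = ereal s" using Gamma0_real_on_edom[OF assms w] by (simp add: s_def)
  have "(w, s - 1) \<notin> epi f" by (simp add: epi_def fw)
  moreover have "convex (epi f)" "closed (epi f)" using assms by (auto simp: Gamma0_def)
  ultimately obtain a b where ab: "inner a (w, s - 1) < b" "\<And>z. z \<in> epi f \<Longrightarrow> inner a z > b"
    using separating_hyperplane_closed_point[of "epi f" "(w, s - 1)"] by blast
  obtain h k where a: "a = (h, k)" by (cases a)
  have "(w, s) \<in> epi f" by (simp add: epi_def fw)
  \<comment> \<open>The separating hyperplane is not vertical, as it separates two points on the
    vertical line through \<open>w\<close>.\<close>
  from ab(1) ab(2)[OF this] have k: "k > 0" by (simp add: a algebra_simps)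
  have "inner (- (h /\<^sub>R k)) u + b / k \<le> r" if "(u, r) \<in> epi f" for u r
    using ab(2)[OF that] k by (simp add: a field_simps)
  then show ?thesis by (rule that)
qed

lemma norm_diff_convex_comb_sq:
  fixes x u v :: "'a::real_inner"
  assumes "a + b = (1::real)"
  shows "(norm (x - (a *\<^sub>R u + b *\<^sub>R v)))\<^sup>2 =
    a * (norm (x - u))\<^sup>2 + b * (norm (x - v))\<^sup>2 - a * b * (norm (u - v))\<^sup>2"
proof -
  have b: "b = 1 - a" using assms by simp
  show ?thesis unfolding b power2_norm_eq_inner
    by (simp add: inner_diff_left inner_diff_right inner_add_left inner_add_right
        inner_commute[of u x] inner_commute[of v x] inner_commute[of v u] algebra_simps)
qed

section \<open>The proximal point\<close>

text \<open>The extended-valued objective is replaced by the continuous real function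
  \<open>(u, r) \<mapsto> r + \<parallel>x - u\<parallel>\<^sup>2 / (2 \<mu>)\<close> on the closed epigraph, whose sublevel sets there are compact.\<close>

lemma prox_obj_minimizer_exists:
  fixes f :: "'a::euclidean_space \<Rightarrow> ereal"
  assumes f: "f \<in> Gamma0" and mu: "\<mu> > 0"
  shows "\<exists>p\<in>edom f. \<forall>u. prox_obj \<mu> f x p \<le> prox_obj \<mu> f x u"
proof -
  define k where "k = 1 / (2 * \<mu>)"
  have k: "k > 0" using mu by (simp add: k_def)
  obtain g c where gc: "\<And>u r. (u, r) \<in> epi f \<Longrightarrow> inner g u + c \<le> r"
    using Gamma0_affine_minorant[OF f] by blast
  obtain w where w: "w \<in> edom f" using f by (auto simp: Gamma0_def)
  define s where "s = real_of_ereal (f w)"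
  have ws: "(w, s) \<in> epi f"
    using Gamma0_real_on_edom[OF f w] by (simp add: epi_def s_def)
  define h :: "'a \<times> real \<Rightarrow> real" where "h = (\<lambda>z. snd z + k * (norm (x - fst z))\<^sup>2)"
  define K where "K = epi f \<inter> {z. h z \<le> h (w, s)}"
  have cont: "continuous_on S h" for S by (auto simp: h_def intro!: continuous_intros)
  have "closed K" unfolding K_def
    using f by (intro closed_Int closed_Collect_le cont continuous_intros) (auto simp: Gamma0_def)
  moreover have "bounded K"
  proof -
    define M where "M = h (w, s) - c - inner g x"
    \<comment> \<open>On \<open>K\<close> the affine minorant gives \<open>k t\<^sup>2 \<le> \<parallel>g\<parallel> t + M\<close> for \<open>t = \<parallel>x - u\<parallel>\<close>, which fails for
      \<open>t > R\<close>; the summand 1 ensures \<open>t > 1\<close> there.\<close>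
    define R where "R = (norm g + 1 + \<bar>M\<bar>) / k + 1"
    have R: "norm (x - u) \<le> R" and r: "\<bar>r\<bar> \<le> \<bar>h (w, s)\<bar> + \<bar>c\<bar> + norm g * (norm x + R)"
      if z: "(u, r) \<in> K" for u r
    proof -
      define t where "t = norm (x - u)"
      have t0: "t \<ge> 0" by (simp add: t_def)
      have e: "(u, r) \<in> epi f" and hr: "r + k * t\<^sup>2 \<le> h (w, s)"
        using z by (auto simp: K_def h_def t_def)
      have "inner g (x - u) \<le> norm g * t" unfolding t_def by (rule norm_cauchy_schwarz)
      then have A: "k * t\<^sup>2 \<le> norm g * t + M"
        using gc[OF e] hr by (simp add: M_def inner_diff_right)
      show "norm (x - u) \<le> R"
      proof (rule ccontr)
        assume "\<not> ?thesis"
        then have tR: "t > R" by (simp add: t_def)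
        then have t1: "t > 1"
          using k by (smt (verit) R_def divide_nonneg_pos norm_ge_zero)
        have "(norm g + 1 + \<bar>M\<bar>) / k < t" using tR by (simp add: R_def)
        then have "norm g + 1 + \<bar>M\<bar> < k * t" using k by (simp add: field_simps)
        then have "(norm g + 1 + \<bar>M\<bar>) * t < k * t * t" using t1 by simp
        moreover have "\<bar>M\<bar> \<le> \<bar>M\<bar> * t" using t1 by (simp add: mult_le_cancel_left1)
        ultimately show False using A t1 by (simp add: power2_eq_square algebra_simps)
      qed
      then have "norm u \<le> norm x + R" using norm_triangle_sub[of u x]
        by (simp add: norm_minus_commute)
      then have "norm g * norm u \<le> norm g * (norm x + R)" by (intro mult_left_mono) auto
      moreover have "- (norm g * norm u) \<le> inner g u"
        using Cauchy_Schwarz_ineq2[of g u] by linarith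
      moreover have "k * t\<^sup>2 \<ge> 0" using k by simp
      ultimately show "\<bar>r\<bar> \<le> \<bar>h (w, s)\<bar> + \<bar>c\<bar> + norm g * (norm x + R)"
        using gc[OF e] hr norm_ge_zero[of u] norm_ge_zero[of g]
          mult_nonneg_nonneg[OF norm_ge_zero[of g] norm_ge_zero[of u]]
        by linarith
    qed
    have "K \<subseteq> cball x R \<times> cball 0 (\<bar>h (w, s)\<bar> + \<bar>c\<bar> + norm g * (norm x + R))"
      using R r by (auto simp: dist_norm)
    then show ?thesis using bounded_Times bounded_cball bounded_subset by metis
  qed
  ultimately have "compact K" by (simp add: compact_eq_bounded_closed)
  moreover have "K \<noteq> {}" using ws by (auto simp: K_def)
  ultimately obtain z where z: "z \<in> K" "\<forall>y\<in>K. h z \<le> h y"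
    using continuous_attains_inf[OF _ _ cont] by blast
  obtain p q where pq: "z = (p, q)" by (cases z)
  have fp: "f p \<le> ereal q" and hz: "h z \<le> h (w, s)" using z pq by (auto simp: K_def epi_def)
  have le: "h z \<le> h y" if "y \<in> epi f" for y
    using z(2) that hz by (cases "h y \<le> h (w, s)") (auto simp: K_def)
  have "prox_obj \<mu> f x p \<le> ereal (h z)"
  proof -
    have "prox_obj \<mu> f x p \<le> ereal q + ereal (k * (norm (x - p))\<^sup>2)"
      unfolding prox_obj_def k_def by (intro add_right_mono fp)
    then show ?thesis by (simp add: h_def pq)
  qed
  moreover have "ereal (h z) \<le> prox_obj \<mu> f x u" for u
  proof (cases "u \<in> edom f")
    case True
    then obtain r where r: "f u = ereal r" using Gamma0_real_on_edom[OF f] by metis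
    then have "h z \<le> h (u, r)" by (intro le) (simp add: epi_def)
    then show ?thesis by (simp add: prox_obj_def r h_def k_def)
  next
    case False
    then show ?thesis by (simp add: prox_obj_def edom_def)
  qed
  ultimately have "\<forall>u. prox_obj \<mu> f x p \<le> prox_obj \<mu> f x u" using order_trans by blast
  moreover have "p \<in> edom f" using fp by (auto simp: edom_def intro: le_less_trans)
  ultimately show ?thesis by blast
qed

lemma prox_obj_minimizer_unique:
  fixes f :: "'a::euclidean_space \<Rightarrow> ereal"
  assumes f: "f \<in> Gamma0" and mu: "\<mu> > 0"
    and p: "p \<in> edom f" "\<And>u. prox_obj \<mu> f x p \<le> prox_obj \<mu> f x u"
    and q: "\<And>u. prox_obj \<mu> f x q \<le> prox_obj \<mu> f x u"
  shows "q = p"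
proof (rule ccontr)
  assume ne: "q \<noteq> p"
  define k where "k = 1 / (2 * \<mu>)"
  have k: "k > 0" using mu by (simp add: k_def)
  define r where "r = real_of_ereal (f p)"
  have r: "f p = ereal r" using Gamma0_real_on_edom[OF f p(1)] by (simp add: r_def)
  have "prox_obj \<mu> f x q \<le> prox_obj \<mu> f x p" by (rule q)
  then have "q \<in> edom f" by (auto simp: prox_obj_def edom_def r)
  then obtain s where s: "f q = ereal s" using Gamma0_real_on_edom[OF f] by metis
  \<comment> \<open>By strong convexity the midpoint would be strictly better than both minimizers.\<close>
  define m where "m = (1/2) *\<^sub>R p + (1/2) *\<^sub>R q"
  have "(1/2) *\<^sub>R (p, r) + (1/2) *\<^sub>R (q, s) \<in> epi f"
    using f r s by (intro convexD) (auto simp: Gamma0_def epi_def)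
  then have fm: "f m \<le> ereal ((r + s) / 2)" by (simp add: epi_def m_def add_divide_distrib)
  have nm: "(norm (x - m))\<^sup>2 =
      (norm (x - p))\<^sup>2 / 2 + (norm (x - q))\<^sup>2 / 2 - (norm (p - q))\<^sup>2 / 4"
    unfolding m_def by (subst norm_diff_convex_comb_sq) auto
  have le: "r + k * (norm (x - p))\<^sup>2 \<le> (r + s) / 2 + k * (norm (x - m))\<^sup>2"
  proof -
    have "prox_obj \<mu> f x p \<le> prox_obj \<mu> f x m" by (rule p)
    also have "\<dots> \<le> ereal ((r + s) / 2) + ereal (k * (norm (x - m))\<^sup>2)"
      unfolding prox_obj_def k_def by (intro add_right_mono fm)
    finally show ?thesis by (simp add: prox_obj_def r k_def)
  qed
  have "s + k * (norm (x - q))\<^sup>2 \<le> r + k * (norm (x - p))\<^sup>2"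
    using q[of p] by (simp add: prox_obj_def r s k_def)
  moreover have "k * (norm (p - q))\<^sup>2 > 0" using k ne by simp
  moreover have "k * (norm (x - m))\<^sup>2 =
      k * (norm (x - p))\<^sup>2 / 2 + k * (norm (x - q))\<^sup>2 / 2 - k * (norm (p - q))\<^sup>2 / 4"
    unfolding nm by (simp add: algebra_simps)
  ultimately show False using le by argo
qed

lemma prox_properties:
  fixes f :: "'a::euclidean_space \<Rightarrow> ereal"
  assumes f: "f \<in> Gamma0" and mu: "\<mu> > 0"
  shows "prox \<mu> f x \<in> edom f"
    and "prox_obj \<mu> f x (prox \<mu> f x) \<le> prox_obj \<mu> f x u"
    and "(\<And>u. prox_obj \<mu> f x q \<le> prox_obj \<mu> f x u) \<Longrightarrow> q = prox \<mu> f x"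
proof -
  obtain p where p: "p \<in> edom f" "\<And>u. prox_obj \<mu> f x p \<le> prox_obj \<mu> f x u"
    using prox_obj_minimizer_exists[OF f mu] by blast
  have uniq: "q = p" if "\<And>u. prox_obj \<mu> f x q \<le> prox_obj \<mu> f x u" for q
    using prox_obj_minimizer_unique[OF f mu p that] .
  have "prox \<mu> f x = (THE u. u \<in> argmin_on (prox_obj \<mu> f x) UNIV)"
    using mu by (simp add: prox_def)
  also have "\<dots> = p"
  proof (rule the_equality)
    show "p \<in> argmin_on (prox_obj \<mu> f x) UNIV"
      using p by (auto simp: argmin_on_def is_arg_min_def not_less)
    show "q = p" if "q \<in> argmin_on (prox_obj \<mu> f x) UNIV" for q
      using that by (intro uniq) (auto simp: argmin_on_def is_arg_min_def not_less)
  qed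
  finally have eq: "prox \<mu> f x = p" .
  show "prox \<mu> f x \<in> edom f" "prox_obj \<mu> f x (prox \<mu> f x) \<le> prox_obj \<mu> f x u"
    using p by (simp_all add: eq)
  show "q = prox \<mu> f x" if "\<And>u. prox_obj \<mu> f x q \<le> prox_obj \<mu> f x u" using uniq[OF that] eq by simp
qed

section \<open>The Lagrangian\<close>

text \<open>The Lagrangian of minimizing half the squared distance to \<open>x\<close> over the level set. Its values
  are meaningful only for \<open>u\<close> in the domain of \<open>f\<close>, where \<open>f\<close> is finite.\<close>

definition lagrangian ::
    "('a::euclidean_space \<Rightarrow> ereal) \<Rightarrow> 'a \<Rightarrow> real \<Rightarrow> real \<Rightarrow> 'a \<Rightarrow> real" where
  "lagrangian f x \<alpha> \<mu> u = \<mu> * (real_of_ereal (f u) - \<alpha>) + (norm (x - u))\<^sup>2 / 2"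

lemma prox_obj_eq_lagrangian:
  fixes f :: "'a::euclidean_space \<Rightarrow> ereal"
  assumes "f \<in> Gamma0" "u \<in> edom f" "\<mu> > 0"
  shows "prox_obj \<mu> f x u = ereal (lagrangian f x \<alpha> \<mu> u / \<mu> + \<alpha>)"
proof -
  obtain r where "f u = ereal r" using Gamma0_real_on_edom[OF assms(1,2)] by metis
  then show ?thesis using assms(3) by (simp add: prox_obj_def lagrangian_def field_simps)
qed

lemma lagrangian_prox_le:
  fixes f :: "'a::euclidean_space \<Rightarrow> ereal"
  assumes f: "f \<in> Gamma0" and mu: "\<mu> > 0" and u: "u \<in> edom f"
  shows "lagrangian f x \<alpha> \<mu> (prox \<mu> f x) \<le> lagrangian f x \<alpha> \<mu> u"
  using prox_properties(2)[OF f mu, of x u] mu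
  by (simp add: prox_obj_eq_lagrangian[OF f prox_properties(1)[OF f mu] mu, where \<alpha> = \<alpha>]
      prox_obj_eq_lagrangian[OF f u mu, where \<alpha> = \<alpha>] divide_le_cancel)

lemma lagrangian_minimizer_eq_prox:
  fixes f :: "'a::euclidean_space \<Rightarrow> ereal"
  assumes f: "f \<in> Gamma0" and mu: "\<mu> > 0" and q: "q \<in> edom f"
    and le: "lagrangian f x \<alpha> \<mu> q \<le> lagrangian f x \<alpha> \<mu> (prox \<mu> f x)"
  shows "q = prox \<mu> f x"
proof (rule prox_properties(3)[OF f mu])
  fix u
  have "prox_obj \<mu> f x q \<le> prox_obj \<mu> f x (prox \<mu> f x)"
    using le mu
    by (simp add: prox_obj_eq_lagrangian[OF f prox_properties(1)[OF f mu] mu, where \<alpha> = \<alpha>]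
      prox_obj_eq_lagrangian[OF f q mu, where \<alpha> = \<alpha>] divide_le_cancel)
  also have "\<dots> \<le> prox_obj \<mu> f x u" by (rule prox_properties(2)[OF f mu])
  finally show "prox_obj \<mu> f x q \<le> prox_obj \<mu> f x u" .
qed

lemma dual_obj_pos:
  fixes f :: "'a::euclidean_space \<Rightarrow> ereal"
  assumes f: "f \<in> Gamma0" and mu: "\<mu> > 0"
  shows "dual_obj f x \<alpha> \<mu> = ereal (- lagrangian f x \<alpha> \<mu> (prox \<mu> f x))"
proof -
  have "envelope \<mu> f x = prox_obj \<mu> f x (prox \<mu> f x)"
    unfolding envelope_def
    by (intro antisym INF_lower INF_greatest prox_properties(2)[OF f mu]) simp
  also have "\<dots> = ereal (lagrangian f x \<alpha> \<mu> (prox \<mu> f x) / \<mu> + \<alpha>)"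
    by (rule prox_obj_eq_lagrangian[OF f prox_properties(1)[OF f mu] mu])
  finally show ?thesis using mu by (simp add: dual_obj_def phi_bar_def field_simps)
qed

lemma infdist_closure_eq: "infdist x (closure S) = infdist x S"
  by (simp add: infdist_eq_setdist setdist_closure_2)

lemma infdist_eq_dist_closest_point:
  assumes "closed S" "S \<noteq> {}"
  shows "infdist x S = dist x (closest_point S x)"
  by (simp add: infdist_eq_setdist setdist_closest_point[OF assms])

lemma dual_obj_zero:
  "dual_obj f x \<alpha> 0 = ereal (- ((infdist x (edom f))\<^sup>2 / 2))"
  by (simp add: dual_obj_def phi_bar_def infdist_closure_eq)

section \<open>Duality\<close>

lemma weak_duality:
  fixes f :: "'a::euclidean_space \<Rightarrow> ereal"
  assumes f: "f \<in> Gamma0" and mu: "\<mu> \<ge> 0" and ne: "lev \<alpha> f \<noteq> {}"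
  shows "ereal (- ((infdist x (lev \<alpha> f))\<^sup>2 / 2)) \<le> dual_obj f x \<alpha> \<mu>"
proof -
  define p where "p = closest_point (lev \<alpha> f) x"
  have p: "p \<in> lev \<alpha> f" and d: "infdist x (lev \<alpha> f) = norm (x - p)"
    using closest_point_in_set[OF Gamma0_lev_closed_convex(1)[OF f] ne]
      infdist_eq_dist_closest_point[OF Gamma0_lev_closed_convex(1)[OF f] ne]
    by (auto simp: p_def dist_norm)
  have pd: "p \<in> edom f" using p by (auto simp: lev_def edom_def intro: le_less_trans)
  have fp: "real_of_ereal (f p) \<le> \<alpha>"
    using p Gamma0_real_on_edom[OF f pd] by (simp add: lev_def) (metis ereal_less_eq(3))
  show ?thesis
  proof (cases "\<mu> = 0")
    case True
    have "infdist x (edom f) \<le> norm (x - p)" using infdist_le[OF pd, of x] by (simp add: dist_norm)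
    then show ?thesis by (simp add: True dual_obj_zero d infdist_nonneg power_mono)
  next
    case False
    with mu have mu: "\<mu> > 0" by simp
    have "lagrangian f x \<alpha> \<mu> p \<le> (norm (x - p))\<^sup>2 / 2"
      using fp mu by (simp add: lagrangian_def mult_le_0_iff)
    then show ?thesis using lagrangian_prox_le[OF f mu pd, of x \<alpha>]
      by (simp add: dual_obj_pos[OF f mu] d)
  qed
qed

text \<open>Separates, in the plane, the values of constraint and objective (and everything above
  them) from the quadrant of feasible points that would beat the optimal value.\<close>

lemma slater_multiplier:
  fixes f :: "'a::euclidean_space \<Rightarrow> ereal"
  assumes f: "f \<in> Gamma0" and slater: "f y < ereal \<alpha>"
  shows "\<exists>\<mu>\<ge>0. \<forall>u\<in>edom f. (infdist x (lev \<alpha> f))\<^sup>2 / 2 \<le> lagrangian f x \<alpha> \<mu> u"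
proof -
  define v where "v = (infdist x (lev \<alpha> f))\<^sup>2 / 2"
  define A where "A = {(s, t). \<exists>u r. (u, r) \<in> epi f \<and> r - \<alpha> \<le> s \<and> (norm (x - u))\<^sup>2 / 2 \<le> t}"
  define B where "B = {..0::real} \<times> {..<v}"
  have AI: "(r - \<alpha>, (norm (x - u))\<^sup>2 / 2) \<in> A" if "(u, r) \<in> epi f" for u r
    using that by (auto simp: A_def)
  have yd: "y \<in> edom f" using slater by (auto simp: edom_def intro: less_trans)
  obtain ry where ry: "f y = ereal ry" using Gamma0_real_on_edom[OF f yd] by metis
  have "convex A"
  proof (rule convexI)
    fix z1 z2 and a b :: real
    assume z: "z1 \<in> A" "z2 \<in> A" and ab: "0 \<le> a" "0 \<le> b" "a + b = 1"
    obtain s1 t1 s2 t2 where z12: "z1 = (s1, t1)" "z2 = (s2, t2)" by (cases z1, cases z2)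
    obtain u1 r1 where 1: "(u1, r1) \<in> epi f" "r1 - \<alpha> \<le> s1" "(norm (x - u1))\<^sup>2 / 2 \<le> t1"
      using z(1) by (auto simp: A_def z12)
    obtain u2 r2 where 2: "(u2, r2) \<in> epi f" "r2 - \<alpha> \<le> s2" "(norm (x - u2))\<^sup>2 / 2 \<le> t2"
      using z(2) by (auto simp: A_def z12)
    have "a *\<^sub>R (u1, r1) + b *\<^sub>R (u2, r2) \<in> epi f"
      using f 1 2 ab by (intro convexD) (auto simp: Gamma0_def)
    moreover have "(a * r1 + b * r2) - \<alpha> \<le> a * s1 + b * s2"
    proof -
      have "a * (r1 - \<alpha>) + b * (r2 - \<alpha>) \<le> a * s1 + b * s2"
        using ab 1 2 by (intro add_mono mult_left_mono)
      moreover have "a * \<alpha> + b * \<alpha> = \<alpha>" using ab by (simp flip: distrib_right)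
      ultimately show ?thesis by (simp add: algebra_simps)
    qed
    moreover have "(norm (x - (a *\<^sub>R u1 + b *\<^sub>R u2)))\<^sup>2 / 2 \<le> a * t1 + b * t2"
    proof -
      have "a * ((norm (x - u1))\<^sup>2 / 2) + b * ((norm (x - u2))\<^sup>2 / 2) \<le> a * t1 + b * t2"
        using ab 1 2 by (intro add_mono mult_left_mono)
      moreover have "a * b * (norm (u1 - u2))\<^sup>2 \<ge> 0" using ab by simp
      ultimately show ?thesis unfolding norm_diff_convex_comb_sq[OF ab(3)] by simp
    qed
    ultimately show "a *\<^sub>R z1 + b *\<^sub>R z2 \<in> A" by (auto simp: A_def z12)
  qed
  moreover have "convex B" unfolding B_def
    by (intro convex_Times) auto
  moreover have "A \<noteq> {}" using AI[of y ry] ry by (auto simp: epi_def)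
  moreover have "B \<noteq> {}"
  proof -
    have "(0, v - 1) \<in> B" by (simp add: B_def)
    then show ?thesis by blast
  qed
  moreover have "B \<inter> A = {}"
  proof -
    have False if "(u, r) \<in> epi f" "r - \<alpha> \<le> s" "s \<le> 0" "(norm (x - u))\<^sup>2 / 2 \<le> t" "t < v" for u r s t
    proof -
      have "f u \<le> ereal r" using that by (simp add: epi_def)
      also have "\<dots> \<le> ereal \<alpha>" using that by simp
      finally have "u \<in> lev \<alpha> f" by (simp add: lev_def)
      then have "infdist x (lev \<alpha> f) \<le> norm (x - u)"
        using infdist_le[of u _ x] by (simp add: dist_norm)
      then have "v \<le> (norm (x - u))\<^sup>2 / 2" by (simp add: v_def infdist_nonneg power_mono)
      then show False using that by linarith
    qed
    then show ?thesis by (fastforce simp: A_def B_def)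
  qed
  ultimately obtain c k where ck: "c \<noteq> 0" "\<forall>z\<in>B. inner c z \<le> k" "\<forall>z\<in>A. inner c z \<ge> k"
    using separating_hyperplane_sets[of B A] by blast
  obtain a b where c: "c = (a, b)" by (cases c)
  have kB: "a * s + b * t \<le> k" if "s \<le> 0" "t < v" for s t
    using ck(2) that by (auto simp: B_def c)
  have kA: "k \<le> a * (r - \<alpha>) + b * ((norm (x - u))\<^sup>2 / 2)" if "(u, r) \<in> epi f" for u r
    using ck(3) AI[OF that] by (auto simp: c)
  \<comment> \<open>A linear functional bounded above on a quadrant that recedes in both directions has
    nonnegative coefficients.\<close>
  have a0: "a \<ge> 0"
  proof (rule ccontr)
    assume "\<not> a \<ge> 0"
    then have a: "a < 0" by simp
    define D where "D = \<bar>k - b * (v - 1)\<bar> + 1"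
    have "a * (D / a) + b * (v - 1) \<le> k"
      using a by (intro kB) (auto simp: D_def divide_le_0_iff)
    then show False using a by (simp add: D_def)
  qed
  have b0: "b \<ge> 0"
  proof (rule ccontr)
    assume "\<not> b \<ge> 0"
    then have b: "b < 0" by simp
    define D where "D = \<bar>k - b * v\<bar> + 1"
    have "a * 0 + b * (v + D / b) \<le> k"
      using b by (intro kB) (auto simp: D_def divide_less_0_iff)
    moreover have "b * (v + D / b) = b * v + D" using b by (simp add: distrib_left)
    ultimately show False by (simp add: D_def)
  qed
  have bv: "b * v \<le> k"
  proof (cases "b = 0")
    case True
    then show ?thesis using kB[of 0 "v - 1"] by simp
  next
    case False
    with b0 have b: "b > 0" by simp
    have "v \<le> k / b"
    proof (rule dense_le)
      fix t assume "t < v"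
      then show "t \<le> k / b" using kB[of 0 t] b by (simp add: field_simps)
    qed
    then show ?thesis using b by (simp add: field_simps)
  qed
  \<comment> \<open>Slater's condition excludes a vertical separating line.\<close>
  have b: "b > 0"
  proof (rule ccontr)
    assume "\<not> b > 0"
    with b0 have b: "b = 0" by simp
    with ck(1) a0 have a: "a > 0" by (auto simp: c zero_prod_def)
    have "0 \<le> a * (ry - \<alpha>)" using kA[of y ry] bv by (simp add: b ry epi_def)
    moreover have "ry < \<alpha>" using slater by (simp add: ry)
    ultimately show False using a by (simp add: zero_le_mult_iff)
  qed
  show ?thesis
  proof (intro exI[of _ "a / b"] conjI ballI)
    show "0 \<le> a / b" using a0 b by simp
    fix u assume u: "u \<in> edom f"
    define r where "r = real_of_ereal (f u)"
    have "(u, r) \<in> epi f" using Gamma0_real_on_edom[OF f u] by (simp add: epi_def r_def)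
    from kA[OF this] bv have "b * v \<le> a * (r - \<alpha>) + b * ((norm (x - u))\<^sup>2 / 2)" by linarith
    then show "(infdist x (lev \<alpha> f))\<^sup>2 / 2 \<le> lagrangian f x \<alpha> (a / b) u"
      using b unfolding lagrangian_def r_def[symmetric] v_def[symmetric]
      by (simp add: field_simps)
  qed
qed

lemma dual_attained:
  fixes f :: "'a::euclidean_space \<Rightarrow> ereal"
  assumes f: "f \<in> Gamma0" and slater: "f y < ereal \<alpha>"
  shows "\<exists>\<mu>\<ge>0. dual_obj f x \<alpha> \<mu> = ereal (- ((infdist x (lev \<alpha> f))\<^sup>2 / 2))"
proof -
  have ne: "lev \<alpha> f \<noteq> {}" using slater by (auto simp: lev_def intro: less_imp_le)
  obtain \<mu> where mu: "\<mu> \<ge> 0"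
    and le: "\<And>u. u \<in> edom f \<Longrightarrow> (infdist x (lev \<alpha> f))\<^sup>2 / 2 \<le> lagrangian f x \<alpha> \<mu> u"
    using slater_multiplier[OF f slater] by blast
  have "dual_obj f x \<alpha> \<mu> \<le> ereal (- ((infdist x (lev \<alpha> f))\<^sup>2 / 2))"
  proof (cases "\<mu> = 0")
    case True
    have dn: "edom f \<noteq> {}" using f by (auto simp: Gamma0_def)
    have "infdist x (lev \<alpha> f) \<le> infdist x (edom f)"
      unfolding infdist_notempty[OF dn]
    proof (rule cINF_greatest[OF dn])
      fix u assume "u \<in> edom f"
      from le[OF this] have "(infdist x (lev \<alpha> f))\<^sup>2 \<le> (dist x u)\<^sup>2"
        by (simp add: True lagrangian_def dist_norm)
      then show "infdist x (lev \<alpha> f) \<le> dist x u" by (rule power2_le_imp_le) simp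
    qed
    then show ?thesis by (simp add: True dual_obj_zero infdist_nonneg power_mono)
  next
    case False
    with mu have "\<mu> > 0" by simp
    then show ?thesis using le[OF prox_properties(1)[OF f \<open>\<mu> > 0\<close>]] by (simp add: dual_obj_pos[OF f])
  qed
  with weak_duality[OF f mu ne] mu show ?thesis by (auto intro: antisym)
qed

lemma dual_optimal_pos_iff:
  fixes f :: "'a::euclidean_space \<Rightarrow> ereal"
  assumes f: "f \<in> Gamma0" and mu: "\<mu> > 0" and ne: "lev \<alpha> f \<noteq> {}"
  shows "dual_obj f x \<alpha> \<mu> = ereal (- ((infdist x (lev \<alpha> f))\<^sup>2 / 2)) \<Longrightarrow>
      closest_point (lev \<alpha> f) x = prox \<mu> f x"
    and "dual_obj f x \<alpha> \<mu> = ereal (- ((infdist x (lev \<alpha> f))\<^sup>2 / 2)) \<longleftrightarrow>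
      f (prox \<mu> f x) = ereal \<alpha>"
proof -
  define p where "p = closest_point (lev \<alpha> f) x"
  define q where "q = prox \<mu> f x"
  have p: "p \<in> lev \<alpha> f" and d: "infdist x (lev \<alpha> f) = norm (x - p)"
    using closest_point_in_set[OF Gamma0_lev_closed_convex(1)[OF f] ne]
      infdist_eq_dist_closest_point[OF Gamma0_lev_closed_convex(1)[OF f] ne]
    by (auto simp: p_def dist_norm)
  have pd: "p \<in> edom f" using p by (auto simp: lev_def edom_def intro: le_less_trans)
  have qd: "q \<in> edom f" unfolding q_def by (rule prox_properties(1)[OF f mu])
  obtain r where r: "f p = ereal r" using Gamma0_real_on_edom[OF f pd] by metis
  have r\<alpha>: "r \<le> \<alpha>" using p by (simp add: lev_def r)
  have Lp: "lagrangian f x \<alpha> \<mu> p = \<mu> * (r - \<alpha>) + (norm (x - p))\<^sup>2 / 2"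
    by (simp add: lagrangian_def r)
  have nonpos: "\<mu> * (r - \<alpha>) \<le> 0" using mu r\<alpha> by (simp add: mult_le_0_iff)
  have fwd: "p = q" "f q = ereal \<alpha>"
    if "dual_obj f x \<alpha> \<mu> = ereal (- ((infdist x (lev \<alpha> f))\<^sup>2 / 2))"
  proof -
    have Lq: "lagrangian f x \<alpha> \<mu> q = (norm (x - p))\<^sup>2 / 2"
      using that by (simp add: dual_obj_pos[OF f mu] d q_def)
    show pq: "p = q" unfolding q_def
      by (rule lagrangian_minimizer_eq_prox[OF f mu pd, of x \<alpha>]) (use Lq Lp nonpos q_def in simp)
    then have "\<mu> * (r - \<alpha>) = 0" using Lq Lp by simp
    then show "f q = ereal \<alpha>" using mu r pq by simp
  qed
  have bwd: "dual_obj f x \<alpha> \<mu> = ereal (- ((infdist x (lev \<alpha> f))\<^sup>2 / 2))" if "f q = ereal \<alpha>"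
  proof (rule antisym)
    have "infdist x (lev \<alpha> f) \<le> norm (x - q)"
      using infdist_le[of q "lev \<alpha> f" x] that by (simp add: lev_def dist_norm)
    then show "dual_obj f x \<alpha> \<mu> \<le> ereal (- ((infdist x (lev \<alpha> f))\<^sup>2 / 2))"
      using that by (simp add: dual_obj_pos[OF f mu] lagrangian_def infdist_nonneg power_mono
          flip: q_def)
    show "ereal (- ((infdist x (lev \<alpha> f))\<^sup>2 / 2)) \<le> dual_obj f x \<alpha> \<mu>"
      using weak_duality[OF f _ ne] mu by simp
  qed
  show "closest_point (lev \<alpha> f) x = prox \<mu> f x"
    if "dual_obj f x \<alpha> \<mu> = ereal (- ((infdist x (lev \<alpha> f))\<^sup>2 / 2))"
    using fwd(1)[OF that] by (simp add: p_def q_def)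
  show "dual_obj f x \<alpha> \<mu> = ereal (- ((infdist x (lev \<alpha> f))\<^sup>2 / 2)) \<longleftrightarrow>
      f (prox \<mu> f x) = ereal \<alpha>"
    using fwd(2) bwd by (auto simp: q_def)
qed

lemma closest_point_lev_eq_closest_point_edom:
  fixes f :: "'a::euclidean_space \<Rightarrow> ereal"
  assumes f: "f \<in> Gamma0" and le: "f (closest_point (closure (edom f)) x) \<le> ereal \<alpha>"
  shows "closest_point (lev \<alpha> f) x = closest_point (closure (edom f)) x"
proof -
  have sub: "lev \<alpha> f \<subseteq> closure (edom f)"
    by (rule order_trans[OF _ closure_subset]) (auto simp: lev_def edom_def intro: le_less_trans)
  show ?thesis
  proof (rule closest_point_unique[symmetric])
    show "convex (lev \<alpha> f)" "closed (lev \<alpha> f)" by (rule Gamma0_lev_closed_convex[OF f])+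
    show "closest_point (closure (edom f)) x \<in> lev \<alpha> f" using le by (simp add: lev_def)
    show "\<forall>z\<in>lev \<alpha> f. dist x (closest_point (closure (edom f)) x) \<le> dist x z"
      using sub by (auto intro!: closest_point_le)
  qed
qed

lemma dual_optimal_zero_iff:
  fixes f :: "'a::euclidean_space \<Rightarrow> ereal"
  assumes f: "f \<in> Gamma0" and ne: "lev \<alpha> f \<noteq> {}"
  shows "dual_obj f x \<alpha> 0 = ereal (- ((infdist x (lev \<alpha> f))\<^sup>2 / 2)) \<longleftrightarrow>
      f (closest_point (closure (edom f)) x) \<le> ereal \<alpha>"
proof -
  define p where "p = closest_point (lev \<alpha> f) x"
  define q where "q = closest_point (closure (edom f)) x"
  have dn: "closure (edom f) \<noteq> {}" using f by (auto simp: Gamma0_def)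
  have p: "p \<in> lev \<alpha> f" and d: "infdist x (lev \<alpha> f) = dist x p"
    using closest_point_in_set[OF Gamma0_lev_closed_convex(1)[OF f] ne]
      infdist_eq_dist_closest_point[OF Gamma0_lev_closed_convex(1)[OF f] ne]
    by (auto simp: p_def)
  have dq: "infdist x (edom f) = dist x q"
    using infdist_eq_dist_closest_point[OF closed_closure dn] by (simp add: q_def infdist_closure_eq)
  have pd: "p \<in> closure (edom f)"
    using p by (intro subsetD[OF closure_subset])
      (auto simp: lev_def edom_def intro: le_less_trans)
  have "dual_obj f x \<alpha> 0 = ereal (- ((infdist x (lev \<alpha> f))\<^sup>2 / 2)) \<longleftrightarrow> dist x q = dist x p"
    by (simp add: dual_obj_zero d dq)
  also have "\<dots> \<longleftrightarrow> f q \<le> ereal \<alpha>"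
  proof
    assume eq: "dist x q = dist x p"
    have "p = q" unfolding q_def
    proof (rule closest_point_unique)
      show "convex (closure (edom f))" by (intro convex_closure Gamma0_edom_convex f)
      show "\<forall>z\<in>closure (edom f). dist x p \<le> dist x z"
        using closest_point_le[OF closed_closure, of _ "edom f" x] by (simp add: q_def flip: eq)
    qed (use pd in auto)
    then show "f q \<le> ereal \<alpha>" using p by (simp add: lev_def)
  next
    assume "f q \<le> ereal \<alpha>"
    then show "dist x q = dist x p"
      using closest_point_lev_eq_closest_point_edom[OF f] by (simp add: p_def q_def)
  qed
  finally show ?thesis by (simp add: q_def)
qed

theorem corollary13:
  fixes f :: "'a::euclidean_space \<Rightarrow> ereal" and xbar :: 'a and \<alpha> :: real
  assumes "f \<in> Gamma0"
    and "\<exists>xhat. f xhat < ereal \<alpha>"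
  shows
    "(argmin_on (dual_obj f xbar \<alpha>) {0..} \<noteq> {} \<and>
      ereal (1/2 * (infdist xbar (lev \<alpha> f))\<^sup>2) = - (INF \<mu>\<in>{0..}. dual_obj f xbar \<alpha> \<mu>)) \<and>
     (f (closest_point (closure (edom f)) xbar) \<le> ereal \<alpha> \<longrightarrow>
        closest_point (lev \<alpha> f) xbar = closest_point (closure (edom f)) xbar) \<and>
     (\<not> f (closest_point (closure (edom f)) xbar) \<le> ereal \<alpha> \<longrightarrow>
        (\<forall>\<mu>\<in>argmin_on (dual_obj f xbar \<alpha>) {0..}. \<mu> > 0 \<longrightarrow>
           closest_point (lev \<alpha> f) xbar = prox \<mu> f xbar)) \<and>
     (f (closest_point (closure (edom f)) xbar) \<ge> ereal \<alpha> \<longrightarrow>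
        argmin_on (dual_obj f xbar \<alpha>) {0..} = {\<mu>. \<mu> \<ge> 0 \<and> f (prox \<mu> f xbar) = ereal \<alpha>} \<and>
        {\<mu>. \<mu> \<ge> 0 \<and> f (prox \<mu> f xbar) = ereal \<alpha>} \<noteq> {})"
proof -
  obtain y where y: "f y < ereal \<alpha>" using assms(2) by blast
  note f = assms(1)
  have ne: "lev \<alpha> f \<noteq> {}" using y by (auto simp: lev_def intro: less_imp_le)
  define v where "v = ereal (- ((infdist xbar (lev \<alpha> f))\<^sup>2 / 2))"
  obtain \<mu> where mu: "\<mu> \<ge> 0" "dual_obj f xbar \<alpha> \<mu> = v"
    using dual_attained[OF f y] by (auto simp: v_def)
  have lower: "v \<le> dual_obj f xbar \<alpha> l" if "l \<ge> 0" for l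
    using weak_duality[OF f that ne] by (simp add: v_def)
  have argmin: "argmin_on (dual_obj f xbar \<alpha>) {0..} = {l. l \<ge> 0 \<and> dual_obj f xbar \<alpha> l = v}"
  proof (intro equalityI subsetI)
    fix l assume "l \<in> argmin_on (dual_obj f xbar \<alpha>) {0..}"
    then have "l \<ge> 0" "dual_obj f xbar \<alpha> l \<le> v"
      using mu by (auto simp: argmin_on_def is_arg_min_def not_less)
    with lower[of l] show "l \<in> {l. l \<ge> 0 \<and> dual_obj f xbar \<alpha> l = v}" by simp
  next
    fix l assume "l \<in> {l. l \<ge> 0 \<and> dual_obj f xbar \<alpha> l = v}"
    then show "l \<in> argmin_on (dual_obj f xbar \<alpha>) {0..}"
      using lower by (auto simp: argmin_on_def is_arg_min_def not_less)
  qed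
  have inf: "(INF l\<in>{0..}. dual_obj f xbar \<alpha> l) = v"
    using mu lower by (intro antisym INF_greatest) (auto intro: INF_lower2)
  have pos: "dual_obj f xbar \<alpha> l = v \<longleftrightarrow> f (prox l f xbar) = ereal \<alpha>" if "l > 0" for l
    using dual_optimal_pos_iff(2)[OF f that ne] by (simp add: v_def)
  have zero: "dual_obj f xbar \<alpha> 0 = v \<longleftrightarrow> f (prox 0 f xbar) = ereal \<alpha>"
    if "f (closest_point (closure (edom f)) xbar) \<ge> ereal \<alpha>"
    using dual_optimal_zero_iff[OF f ne, of xbar] that by (auto simp: v_def prox_def)
  have set_eq: "argmin_on (dual_obj f xbar \<alpha>) {0..} = {\<mu>. \<mu> \<ge> 0 \<and> f (prox \<mu> f xbar) = ereal \<alpha>}"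
    if "f (closest_point (closure (edom f)) xbar) \<ge> ereal \<alpha>"
    unfolding argmin using pos zero[OF that] by (auto simp: order_le_less)
  have ne_argmin: "argmin_on (dual_obj f xbar \<alpha>) {0..} \<noteq> {}" using argmin mu by auto
  have proj: "closest_point (lev \<alpha> f) xbar = prox l f xbar"
    if "l \<in> argmin_on (dual_obj f xbar \<alpha>) {0..}" "l > 0" for l
    using dual_optimal_pos_iff(1)[OF f that(2) ne] that(1) argmin by (auto simp: v_def)
  show ?thesis
  proof (intro conjI impI ballI)
    show "ereal (1/2 * (infdist xbar (lev \<alpha> f))\<^sup>2) = - (INF \<mu>\<in>{0..}. dual_obj f xbar \<alpha> \<mu>)"
      by (simp add: inf v_def)
  qed (use ne_argmin proj set_eq closest_point_lev_eq_closest_point_edom[OF f] in auto)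
qed

end
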